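(* Let $R$ be a Boolean algebra, regarded as the semiring $(R,\vee,\wedge,0,1)$, and let $\mathbf E$ be an algebra of type $\tau$. Then the semiring power $\mathbf E[R]$ is isomorphic to the Boolean power $\mathcal C(R^*,\mathbf E)$.
   Context: Let $\mathbf E$ have universe $E$. $V$ is the free left $R$-semimodule with basis $E$: finite-support formal sums $\mathbf v=\sum_{\mathsf d\in E}v_{\mathsf d}\mathsf d$ ($v_{\mathsf d}\in R$), with coordinatewise addition and $r\mathbf v=\sum(rv_{\mathsf d})\mathsf d$; $\mathsf d\in E$ is identified with the vector having coordinate $1$ at $\mathsf d$ and $0$ elsewhere. For $k$-ary $g\in\tau$: $g^V(\mathbf v^1,\dots,\mathbf v^k)=\sum_{\mathsf d_1,\dots,\mathsf d_k\in E}(v^1_{\mathsf d_1}\cdots v^k_{\mathsf d_k})\,g^{\mathbf E}(\mathsf d_1,\dots,\mathsf d_k)$ (semiring operations of $R$). For finite nonempty $I=\{\mathsf e_1,\dots,\mathsf e_n\}\subseteq E$ (fixed order), $q_I(\mathbf v,\mathbf w^1,\dots,\mathbf w^n)=\sum_i v_{\mathsf e_i}\mathbf w^i$. $V_{\mathbf E}$ is the algebra on $V$ with the semimodule operations, all $g^V$, all $q_I$, and all $\mathsf e\in E$ as constants; $\theta(a,b)$ is its smallest congruence containing $(a,b)$. A vector $\mathbf v$ is $I$-central if $\mathbf u\mapsto(\mathbf u/\theta(\mathbf v,\mathsf e_1),\dots,\mathbf u/\theta(\mathbf v,\mathsf e_n))$ is an isomorphism from $V_{\mathbf E}$ onto $\prod_i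 V_{\mathbf E}/\theta(\mathbf v,\mathsf e_i)$; finitely central if $I$-central for some finite nonempty $I$. $E[R]$, the set of finitely central vectors, is closed under every $g^V$, and the semiring power is $\mathbf E[R]=(E[R],g^V|_{E[R]})_{g\in\tau}$. $R^*$ is the Stone space of $R$ (ultrafilters of $R$ with the Stone topology); $\mathcal C(R^*,\mathbf E)$ is the algebra of continuous functions $R^*\to E$, where $E$ has the discrete topology, with operations of $\mathbf E$ defined pointwise. *)

theory Defs
  imports "HOL-Algebra.Module" "HOL-Analysis.Abstract_Topology"
begin

section \<open>Universal algebra\<close>

record 'g signature =
  symbols :: "'g set"
  arity :: "'g \<Rightarrow> nat"

record ('g, 'a) ualgebra = "'a partial_object" +
  oper :: "'g \<Rightarrow> 'a list \<Rightarrow> 'a"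

definition tuples :: "'a set \<Rightarrow> nat \<Rightarrow> 'a list set" where
  "tuples A k = {xs. length xs = k \<and> set xs \<subseteq> A}"

definition is_algebra :: "'g signature \<Rightarrow> ('g, 'a) ualgebra \<Rightarrow> bool" where
  "is_algebra \<tau> A \<longleftrightarrow> carrier A \<noteq> {} \<and>
     (\<forall>g\<in>symbols \<tau>. \<forall>xs\<in>tuples (carrier A) (arity \<tau> g). oper A g xs \<in> carrier A)"

definition alg_iso ::
  "'g signature \<Rightarrow> ('g, 'a) ualgebra \<Rightarrow> ('g, 'b) ualgebra \<Rightarrow> ('a \<Rightarrow> 'b) \<Rightarrow> bool" where
  "alg_iso \<tau> A B h \<longleftrightarrow>
     is_algebra \<tau> A \<and> is_algebra \<tau> B \<and> bij_betw h (carrier A) (carrier B) \<and>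
     (\<forall>g\<in>symbols \<tau>. \<forall>xs\<in>tuples (carrier A) (arity \<tau> g).
        h (oper A g xs) = oper B g (map h xs))"

definition isomorphic_algebras ::
  "'g signature \<Rightarrow> ('g, 'a) ualgebra \<Rightarrow> ('g, 'b) ualgebra \<Rightarrow> bool" where
  "isomorphic_algebras \<tau> A B \<longleftrightarrow> (\<exists>h. alg_iso \<tau> A B h)"

definition is_congruence :: "'g signature \<Rightarrow> ('g, 'a) ualgebra \<Rightarrow> ('a \<times> 'a) set \<Rightarrow> bool" where
  "is_congruence \<tau> A \<theta> \<longleftrightarrow> equiv (carrier A) \<theta> \<and>
     (\<forall>g\<in>symbols \<tau>. \<forall>xs\<in>tuples (carrier A) (arity \<tau> g). \<forall>ys\<in>tuples (carrier A) (arity \<tau> g).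
        list_all2 (\<lambda>x y. (x, y) \<in> \<theta>) xs ys \<longrightarrow> (oper A g xs, oper A g ys) \<in> \<theta>)"

definition principal_cong ::
  "'g signature \<Rightarrow> ('g, 'a) ualgebra \<Rightarrow> 'a \<Rightarrow> 'a \<Rightarrow> ('a \<times> 'a) set" where
  "principal_cong \<tau> A a b = \<Inter> {\<theta>. is_congruence \<tau> A \<theta> \<and> (a, b) \<in> \<theta>}"

text \<open>
  For a congruence \<open>\<theta>\<close>, the operation of the quotient sends classes \<open>Xs\<close> to the class of
  \<open>oper A g xs\<close>, for any choice of representatives \<open>xs\<close>; the set below is that class.
\<close>
definition quotient_alg ::
  "('g, 'a) ualgebra \<Rightarrow> ('a \<times> 'a) set \<Rightarrow> ('g, 'a set) ualgebra" where
  "quotient_alg A \<theta> =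
     \<lparr>carrier = carrier A // \<theta>,
      oper = \<lambda>g Xs. {y. \<exists>xs. list_all2 (\<in>) xs Xs \<and> (oper A g xs, y) \<in> \<theta>}\<rparr>"

definition product_alg ::
  "'i set \<Rightarrow> ('i \<Rightarrow> ('g, 'a) ualgebra) \<Rightarrow> ('g, 'i \<Rightarrow> 'a) ualgebra" where
  "product_alg I A =
     \<lparr>carrier = (\<Pi>\<^sub>E i\<in>I. carrier (A i)),
      oper = \<lambda>g fs. \<lambda>i\<in>I. oper (A i) g (map (\<lambda>f. f i) fs)\<rparr>"


section \<open>The algebra of vectors over a semiring\<close>

text \<open>
  A formal sum over \<open>E\<close> is its coordinate function, extended by zero outside \<open>E\<close>. The fields
  \<open>mult\<close> and \<open>one\<close> are an artefact of the record type for modules.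
\<close>
definition free_semimodule :: "'r ring \<Rightarrow> 'e set \<Rightarrow> ('r, 'e \<Rightarrow> 'r) module" where
  "free_semimodule R E =
     \<lparr>carrier = {v. (\<forall>d\<in>E. v d \<in> carrier R) \<and> (\<forall>d. d \<notin> E \<longrightarrow> v d = \<zero>\<^bsub>R\<^esub>) \<and>
                    finite {d. v d \<noteq> \<zero>\<^bsub>R\<^esub>}},
      mult = undefined, one = undefined,
      zero = (\<lambda>d. \<zero>\<^bsub>R\<^esub>),
      add = (\<lambda>v w d. v d \<oplus>\<^bsub>R\<^esub> w d),
      smult = (\<lambda>r v d. r \<otimes>\<^bsub>R\<^esub> v d)\<rparr>"

definition unit_vec :: "'r ring \<Rightarrow> 'e \<Rightarrow> 'e \<Rightarrow> 'r" where
  "unit_vec R e = (\<lambda>d. if d = e then \<one>\<^bsub>R\<^esub> else \<zero>\<^bsub>R\<^esub>)"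

definition coord_prod :: "'r ring \<Rightarrow> ('e \<Rightarrow> 'r) list \<Rightarrow> 'e list \<Rightarrow> 'r" where
  "coord_prod R vs ds = foldr (\<otimes>\<^bsub>R\<^esub>) (map2 (\<lambda>v d. v d) vs ds) \<one>\<^bsub>R\<^esub>"

text \<open>
  The sum over all tuples of elements of \<open>E\<close> has only finitely many nonzero coefficients; it is
  taken over the tuples with nonzero coefficient, since \<open>finsum\<close> needs a finite index set.
\<close>
definition lifted_op ::
  "'r ring \<Rightarrow> ('g, 'e) ualgebra \<Rightarrow> 'g \<Rightarrow> ('e \<Rightarrow> 'r) list \<Rightarrow> 'e \<Rightarrow> 'r" where
  "lifted_op R E g vs =
     finsum (free_semimodule R (carrier E))
       (\<lambda>ds. coord_prod R vs ds \<odot>\<^bsub>free_semimodule R (carrier E)\<^esub> unit_vec R (oper E g ds))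
       {ds \<in> tuples (carrier E) (length vs). coord_prod R vs ds \<noteq> \<zero>\<^bsub>R\<^esub>}"

text \<open>An arbitrary but fixed order on a finite \<open>I\<close>; it matches the arguments of \<open>q_op\<close> with the elements of \<open>I\<close>.\<close>
definition enum_of :: "'e set \<Rightarrow> 'e list" where
  "enum_of I = (SOME es. distinct es \<and> set es = I)"

definition q_op ::
  "'r ring \<Rightarrow> 'e set \<Rightarrow> 'e set \<Rightarrow> ('e \<Rightarrow> 'r) \<Rightarrow> ('e \<Rightarrow> 'r) list \<Rightarrow> 'e \<Rightarrow> 'r" where
  "q_op R E I v ws =
     finsum (free_semimodule R E)
       (\<lambda>i. v (enum_of I ! i) \<odot>\<^bsub>free_semimodule R E\<^esub> (ws ! i)) {..<card I}"

datatype ('r, 'g, 'e) vsym =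
  VZero | VAdd | VScale 'r | VLift 'g | VQ "'e set" | VConst 'e

definition vec_sig ::
  "'g signature \<Rightarrow> 'r ring \<Rightarrow> ('g, 'e) ualgebra \<Rightarrow> ('r, 'g, 'e) vsym signature" where
  "vec_sig \<tau> R E =
     \<lparr>symbols = {VZero, VAdd} \<union> VScale ` carrier R \<union> VLift ` symbols \<tau> \<union>
                VQ ` {I. finite I \<and> I \<noteq> {} \<and> I \<subseteq> carrier E} \<union> VConst ` carrier E,
      arity = (\<lambda>s. case s of
         VZero \<Rightarrow> 0
       | VAdd \<Rightarrow> 2
       | VScale r \<Rightarrow> 1
       | VLift g \<Rightarrow> arity \<tau> g
       | VQ I \<Rightarrow> Suc (card I)
       | VConst e \<Rightarrow> 0)\<rparr>"

definition vec_alg ::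
  "'r ring \<Rightarrow> ('g, 'e) ualgebra \<Rightarrow> (('r, 'g, 'e) vsym, 'e \<Rightarrow> 'r) ualgebra" where
  "vec_alg R E = (let V = free_semimodule R (carrier E) in
     \<lparr>carrier = carrier V,
      oper = (\<lambda>s vs. case s of
         VZero \<Rightarrow> \<zero>\<^bsub>V\<^esub>
       | VAdd \<Rightarrow> (vs ! 0) \<oplus>\<^bsub>V\<^esub> (vs ! 1)
       | VScale r \<Rightarrow> r \<odot>\<^bsub>V\<^esub> (vs ! 0)
       | VLift g \<Rightarrow> lifted_op R E g vs
       | VQ I \<Rightarrow> q_op R (carrier E) I (hd vs) (tl vs)
       | VConst e \<Rightarrow> unit_vec R e)\<rparr>)"


section \<open>Central vectors and the semiring power\<close>

definition vec_cong ::
  "'g signature \<Rightarrow> 'r ring \<Rightarrow> ('g, 'e) ualgebra \<Rightarrow> ('e \<Rightarrow> 'r) \<Rightarrow> 'e \<Rightarrow>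
   (('e \<Rightarrow> 'r) \<times> ('e \<Rightarrow> 'r)) set" where
  "vec_cong \<tau> R E v e = principal_cong (vec_sig \<tau> R E) (vec_alg R E) v (unit_vec R e)"

text \<open>The product of the quotients is indexed by the elements of \<open>I\<close> themselves.\<close>
definition central_wrt ::
  "'g signature \<Rightarrow> 'r ring \<Rightarrow> ('g, 'e) ualgebra \<Rightarrow> 'e set \<Rightarrow> ('e \<Rightarrow> 'r) \<Rightarrow> bool" where
  "central_wrt \<tau> R E I v \<longleftrightarrow>
     alg_iso (vec_sig \<tau> R E) (vec_alg R E)
       (product_alg I (\<lambda>e. quotient_alg (vec_alg R E) (vec_cong \<tau> R E v e)))
       (\<lambda>u. \<lambda>e\<in>I. vec_cong \<tau> R E v e `` {u})"

definition finitely_central ::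
  "'g signature \<Rightarrow> 'r ring \<Rightarrow> ('g, 'e) ualgebra \<Rightarrow> ('e \<Rightarrow> 'r) \<Rightarrow> bool" where
  "finitely_central \<tau> R E v \<longleftrightarrow> v \<in> carrier (vec_alg R E) \<and>
     (\<exists>I. finite I \<and> I \<noteq> {} \<and> I \<subseteq> carrier E \<and> central_wrt \<tau> R E I v)"

definition semiring_power ::
  "'g signature \<Rightarrow> ('g, 'e) ualgebra \<Rightarrow> 'r ring \<Rightarrow> ('g, 'e \<Rightarrow> 'r) ualgebra" where
  "semiring_power \<tau> E R =
     \<lparr>carrier = {v. finitely_central \<tau> R E v}, oper = lifted_op R E\<rparr>"


section \<open>Boolean algebras, Stone spaces and Boolean powers\<close>

definition boolean_semiring :: "'r::boolean_algebra ring" where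
  "boolean_semiring = \<lparr>carrier = UNIV, mult = inf, one = Orderings.top, zero = bot, add = sup\<rparr>"

lemma semiring_boolean_semiring: "semiring (boolean_semiring :: 'r::boolean_algebra ring)"
  by unfold_locales
    (auto simp: boolean_semiring_def ac_simps
       inf_sup_distrib1)

definition proper_filter :: "'r::boolean_algebra set \<Rightarrow> bool" where
  "proper_filter F \<longleftrightarrow> Orderings.top \<in> F \<and> bot \<notin> F \<and> (\<forall>a\<in>F. \<forall>b\<in>F. inf a b \<in> F) \<and>
     (\<forall>a\<in>F. \<forall>b. a \<le> b \<longrightarrow> b \<in> F)"

definition ultrafilter :: "'r::boolean_algebra set \<Rightarrow> bool" where
  "ultrafilter F \<longleftrightarrow> proper_filter F \<and> (\<forall>G. proper_filter G \<and> F \<subseteq> G \<longrightarrow> G = F)"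

definition stone_space :: "'r::boolean_algebra set topology" where
  "stone_space = topology_generated_by (range (\<lambda>a. {F. ultrafilter F \<and> a \<in> F}))"

lemma topspace_stone_space: "topspace stone_space = {F. ultrafilter F}"
  by (auto simp: stone_space_def ultrafilter_def proper_filter_def)

definition continuous_alg ::
  "'x topology \<Rightarrow> ('g, 'e) ualgebra \<Rightarrow> ('g, 'x \<Rightarrow> 'e) ualgebra" where
  "continuous_alg X E =
     \<lparr>carrier = {f \<in> extensional (topspace X). continuous_map X (discrete_topology (carrier E)) f},
      oper = \<lambda>g fs. \<lambda>x\<in>topspace X. oper E g (map (\<lambda>f. f x) fs)\<rparr>"

end

theory Submission
  imports Defs
begin

text \<open>
  Each ultrafilter \<open>F\<close> of the Boolean algebra is a semiring homomorphism to \<open>{0, 1}\<close>, and these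
  homomorphisms separate points, so every identity between vectors is checked pointwise at the
  ultrafilters. A vector \<open>v\<close> is finitely central iff for every \<open>F\<close> exactly one coordinate of \<open>v\<close>
  lies in \<open>F\<close>. If \<open>v\<close> is \<open>I\<close>-central, then \<open>q\<^sub>I(v, -)\<close> is the projection to the \<open>e\<close>-th argument
  modulo \<open>\<theta>(v, e)\<close>, hence \<open>q\<^sub>I(v, -)\<close> is idempotent, diagonal and reproduces \<open>v\<close> from the
  constants of \<open>I\<close>; these three identities say that \<open>v\<close> is a partition of unity. Conversely,
  for a partition of unity agreement on the ultrafilters containing \<open>v\<^sub>e\<close> is a congruence
  identifying \<open>v\<close> and \<open>e\<close>, which gives injectivity, and \<open>q\<^sub>I(v, -)\<close> gives surjectivity.
  The isomorphism sends \<open>v\<close> to the function taking \<open>F\<close> to the unique \<open>d\<close> with \<open>v\<^sub>d \<in> F\<close>; it is onto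
  because the Stone space is compact.
\<close>

section \<open>Ultrafilters\<close>

text \<open>Ultrafilters are defined as maximal proper filters, so this is Zorn's lemma for the
  proper filters above \<open>G\<close>. The union of a nonempty chain is again closed under meets,
  since two of its elements lie in a common member of the chain.\<close>

lemma ultrafilter_extends:
  assumes "proper_filter G"
  obtains F where "ultrafilter F" "G \<subseteq> F"
proof -
  let ?A = "{F. proper_filter F \<and> G \<subseteq> F}"
  have "\<exists>M\<in>?A. \<forall>X\<in>?A. M \<subseteq> X \<longrightarrow> X = M"
  proof (rule subset_Zorn_nonempty)
    show "?A \<noteq> {}" using assms by blast
  next
    fix C assume ne: "C \<noteq> {}" and C: "subset.chain ?A C"
    have pf: "proper_filter F" "G \<subseteq> F" if "F \<in> C" for F
      using C that unfolding subset.chain_def by auto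
    have "inf a b \<in> \<Union>C" if ab: "a \<in> \<Union>C" "b \<in> \<Union>C" for a b
    proof -
      obtain K L where KL: "K \<in> C" "L \<in> C" "a \<in> K" "b \<in> L" using ab by auto
      moreover from KL have "K \<subseteq> L \<or> L \<subseteq> K"
        using C unfolding subset.chain_def by blast
      ultimately show ?thesis
        using pf(1)[OF KL(1)] pf(1)[OF KL(2)] unfolding proper_filter_def by (metis UnionI subsetD)
    qed
    moreover have "Orderings.top \<in> \<Union>C" "bot \<notin> \<Union>C"
      using pf(1) ne by (auto simp: proper_filter_def)
    moreover have "b \<in> \<Union>C" if "a \<in> \<Union>C" "a \<le> b" for a b
      using pf(1) that unfolding proper_filter_def by (metis UnionE UnionI)
    ultimately have "proper_filter (\<Union>C)"
      unfolding proper_filter_def by blast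
    then show "\<Union>C \<in> ?A" using pf(2) ne by blast
  qed
  then obtain M where "proper_filter M" "G \<subseteq> M" "\<forall>X\<in>?A. M \<subseteq> X \<longrightarrow> X = M" by blast
  then have "ultrafilter M" unfolding ultrafilter_def by blast
  with \<open>G \<subseteq> M\<close> show thesis using that by blast
qed

context
  fixes F :: "'r::boolean_algebra set"
  assumes F: "ultrafilter F"
begin

lemma ultrafilter_top [simp]: "Orderings.top \<in> F"
  and ultrafilter_bot [simp]: "bot \<notin> F"
  and ultrafilter_up: "a \<in> F \<Longrightarrow> a \<le> b \<Longrightarrow> b \<in> F"
  using F by (auto simp: ultrafilter_def proper_filter_def)

lemma ultrafilter_inf: "inf a b \<in> F \<longleftrightarrow> a \<in> F \<and> b \<in> F"
  using F ultrafilter_up[of "inf a b"] unfolding ultrafilter_def proper_filter_def by auto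

text \<open>If neither \<open>a\<close> nor \<open>- a\<close> lay in \<open>F\<close>, the filter
  \<open>?G\<close> generated by \<open>F\<close> and \<open>a\<close> would still be proper:
  \<open>inf f a = bot\<close> means \<open>f \<le> - a\<close>, which would put \<open>- a\<close>
  into \<open>F\<close>. Maximality then gives \<open>?G = F\<close>, although
  \<open>a \<in> ?G\<close>.\<close>

lemma ultrafilter_compl: "- a \<in> F \<longleftrightarrow> a \<notin> F"
proof
  assume "- a \<in> F"
  then show "a \<notin> F" using ultrafilter_inf[of a "- a"] by auto
next
  assume a: "a \<notin> F"
  show "- a \<in> F"
  proof (rule ccontr)
    assume na: "- a \<notin> F"
    let ?G = "{x. \<exists>f\<in>F. inf f a \<le> x}"
    have "bot \<notin> ?G"
      using na ultrafilter_up by (auto simp: bot_unique inf_shunt)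
    moreover have "inf x y \<in> ?G" if "x \<in> ?G" "y \<in> ?G" for x y
    proof -
      from that obtain f g where "f \<in> F" "g \<in> F" "inf f a \<le> x" "inf g a \<le> y" by auto
      then have "inf f g \<in> F" "inf (inf f g) a \<le> inf x y"
        by (auto simp: ultrafilter_inf) (meson inf.bounded_iff inf.cobounded1 inf.cobounded2 order_trans)+
      then show ?thesis by blast
    qed
    moreover have "Orderings.top \<in> ?G"
      by (intro CollectI bexI[OF _ ultrafilter_top]) simp
    ultimately have "proper_filter ?G"
      unfolding proper_filter_def by (blast intro: order_trans)
    moreover have "F \<subseteq> ?G" by (auto intro: le_infI1)
    ultimately have "?G = F" using F unfolding ultrafilter_def by blast
    moreover have "a \<in> ?G"
      by (intro CollectI bexI[OF _ ultrafilter_top]) simp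
    ultimately show False using a by blast
  qed
qed

lemma ultrafilter_sup: "sup a b \<in> F \<longleftrightarrow> a \<in> F \<or> b \<in> F"
  using ultrafilter_compl[of "sup a b"] ultrafilter_inf[of "- a" "- b"]
  by (auto simp: ultrafilter_compl)

end

text \<open>The principal filter of a nonzero element is proper, so it extends to an
  ultrafilter.\<close>

lemma ultrafilter_containing:
  assumes "a \<noteq> (bot :: 'r::boolean_algebra)"
  obtains F where "ultrafilter F" "a \<in> F"
proof -
  have "proper_filter {x. a \<le> x}"
    using assms by (auto simp: proper_filter_def le_bot)
  then show thesis using that by (rule ultrafilter_extends) auto
qed

text \<open>If \<open>x \<le> y\<close> fails, then \<open>inf x (- y)\<close> is nonzero, and an
  ultrafilter containing it contains \<open>x\<close> but not \<open>y\<close>.\<close>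

lemma eq_if_same_ultrafilters:
  fixes a b :: "'r::boolean_algebra"
  assumes "\<And>F. ultrafilter F \<Longrightarrow> a \<in> F \<longleftrightarrow> b \<in> F"
  shows "a = b"
proof -
  have "x \<le> y" if *: "\<And>F. ultrafilter F \<Longrightarrow> x \<in> F \<Longrightarrow> y \<in> F" for x y :: 'r
  proof (rule ccontr)
    assume "\<not> x \<le> y"
    then have "inf x (- y) \<noteq> bot" by (simp add: inf_shunt)
    then obtain F where "ultrafilter F" "inf x (- y) \<in> F" by (rule ultrafilter_containing)
    then show False using * by (auto simp: ultrafilter_inf ultrafilter_compl)
  qed
  with assms show ?thesis by (meson order.antisym)
qed

lemma eq_bot_if_no_ultrafilter:
  fixes a :: "'r::boolean_algebra"
  assumes "\<And>F. ultrafilter F \<Longrightarrow> a \<notin> F"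
  shows "a = bot"
  using assms ultrafilter_containing by blast

text \<open>This is compactness of the Stone space for covers by basic clopen sets.
  \<open>P B x\<close> says that \<open>x\<close> lies in every ultrafilter missing the finite set
  \<open>B\<close>, that is, above the meet of the complements of \<open>B\<close>. If no finite
  \<open>B\<close> covered, these \<open>x\<close> would form a proper filter containing
  \<open>- a\<close> for all \<open>a \<in> A\<close>, and an ultrafilter above it would avoid all
  of \<open>A\<close>.\<close>

lemma ultrafilter_finite_subcover:
  fixes A :: "'r::boolean_algebra set"
  assumes cover: "\<And>F. ultrafilter F \<Longrightarrow> \<exists>a\<in>A. a \<in> F"
  shows "\<exists>B. finite B \<and> B \<subseteq> A \<and> (\<forall>F. ultrafilter F \<longrightarrow> (\<exists>a\<in>B. a \<in> F))"
proof (rule ccontr)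
  assume neg: "\<not> ?thesis"
  have no: "\<exists>F. ultrafilter F \<and> (\<forall>a\<in>B. a \<notin> F)" if B: "finite B" "B \<subseteq> A" for B
    using neg[unfolded not_ex, rule_format, of B] B by auto
  define P where "P B x \<longleftrightarrow> finite B \<and> B \<subseteq> A \<and>
    (\<forall>F. ultrafilter F \<longrightarrow> (\<forall>b\<in>B. b \<notin> F) \<longrightarrow> x \<in> F)" for B x
  have "P {} Orderings.top" by (simp add: P_def)
  moreover have "\<not> P B bot" for B
    using no[of B] by (auto simp: P_def)
  moreover have "P (B \<union> C) (inf x y)" if "P B x" "P C y" for B C x y
    using that by (auto simp: P_def ultrafilter_inf)
  moreover have "P B y" if "P B x" "x \<le> y" for B x y
    using that(1) ultrafilter_up[OF _ _ that(2)] by (simp add: P_def)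
  ultimately have "proper_filter {x. \<exists>B. P B x}"
    unfolding proper_filter_def mem_Collect_eq Ball_def by (intro conjI allI impI) (blast | fast)+
  then obtain U where U: "ultrafilter U" "{x. \<exists>B. P B x} \<subseteq> U" by (rule ultrafilter_extends)
  then obtain a where a: "a \<in> A" "a \<in> U" using cover by blast
  then have "P {a} (- a)" by (simp add: P_def ultrafilter_compl)
  then have "- a \<in> U" using U(2) by blast
  then show False using a(2) ultrafilter_compl[OF U(1)] by simp
qed

text \<open>The witness is the join of \<open>B\<close>, built by induction and described by the
  ultrafilters containing it, which is the form used when a vector is assembled from a continuous
  function.\<close>

lemma finite_join_exists:
  assumes "finite (B :: 'r::boolean_algebra set)"
  shows "\<exists>c. \<forall>F. ultrafilter F \<longrightarrow> (c \<in> F \<longleftrightarrow> (\<exists>a\<in>B. a \<in> F))"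
  using assms
proof induction
  case empty
  show ?case by (auto intro!: exI[of _ bot])
next
  case (insert x B)
  then obtain c where "\<forall>F. ultrafilter F \<longrightarrow> (c \<in> F \<longleftrightarrow> (\<exists>a\<in>B. a \<in> F))" by blast
  then show ?case by (auto intro!: exI[of _ "sup x c"] simp: ultrafilter_sup)
qed

text \<open>The sets of ultrafilters containing a given element generate the topology only as a
  subbasis. They form a basis because the intersection of the sets for \<open>a\<close> and
  \<open>b\<close> is the set for \<open>inf a b\<close>.\<close>

lemma stone_space_basis:
  fixes U :: "'r::boolean_algebra set set"
  assumes "openin stone_space U" "F \<in> U"
  shows "\<exists>a\<in>F. \<forall>G. ultrafilter G \<and> a \<in> G \<longrightarrow> G \<in> U"
proof -
  have "generate_topology_on (range (\<lambda>a. {F. ultrafilter F \<and> a \<in> F})) U"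
    using assms(1) by (simp add: stone_space_def openin_topology_generated_by_iff)
  then show ?thesis using assms(2)
  proof (induction arbitrary: F)
    case (Int U W)
    \<comment> \<open>Openness of \<open>U\<close> places its member \<open>F\<close> in the space,
      so \<open>F\<close> is an ultrafilter and contains \<open>inf a b\<close> along with
      \<open>a\<close> and \<open>b\<close>.\<close>
    have "openin stone_space U"
      using Int.hyps(1) by (simp add: stone_space_def openin_topology_generated_by_iff)
    then have F: "ultrafilter F"
      using openin_subset[of stone_space U] Int.prems by (auto simp: topspace_stone_space)
    from Int obtain a b where "a \<in> F" "b \<in> F"
      "\<forall>G. ultrafilter G \<and> a \<in> G \<longrightarrow> G \<in> U" "\<forall>G. ultrafilter G \<and> b \<in> G \<longrightarrow> G \<in> W"
      by (metis IntE)
    with F show ?case by (intro bexI[of _ "inf a b"]) (auto simp: ultrafilter_inf)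
  next
    case (UN K)
    from UN.prems obtain k where k: "k \<in> K" "F \<in> k" by blast
    from UN.IH[OF this] obtain a where "a \<in> F" "\<forall>G. ultrafilter G \<and> a \<in> G \<longrightarrow> G \<in> k"
      by (rule bexE)
    with k show ?case by (intro bexI[of _ a]) auto
  next
    case (Basis s)
    then obtain a where "s = {F. ultrafilter F \<and> a \<in> F}" by auto
    with Basis.prems show ?case by (intro bexI[of _ a]) auto
  qed simp
qed


section \<open>Congruences and quotients\<close>

lemma equiv_trans: "equiv A r \<Longrightarrow> (x, y) \<in> r \<Longrightarrow> (y, z) \<in> r \<Longrightarrow> (x, z) \<in> r"
  by (auto simp: equiv_def dest: transD)

lemma equiv_trans_sym: "equiv A r \<Longrightarrow> (x, y) \<in> r \<Longrightarrow> (z, y) \<in> r \<Longrightarrow> (x, z) \<in> r"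
  by (auto simp: equiv_def dest: symD transD)

lemma list_all2_set2E:
  assumes "list_all2 P xs ys" "y \<in> set ys"
  obtains x where "x \<in> set xs" "P x y"
  using assms by (metis in_set_conv_nth list_all2_conv_all_nth)

text \<open>An intersection of congruences is a congruence as soon as the family is nonempty. Here
  the full relation on the carrier belongs to the family, which also keeps the intersection inside
  \<open>carrier A \<times> carrier A\<close>.\<close>

lemma is_congruence_principal_cong:
  assumes A: "is_algebra \<tau> A" and "a \<in> carrier A" "b \<in> carrier A"
  shows "is_congruence \<tau> A (principal_cong \<tau> A a b)"
proof -
  let ?C = "{\<theta>. is_congruence \<tau> A \<theta> \<and> (a, b) \<in> \<theta>}"
  have "carrier A \<times> carrier A \<in> ?C"
    using assms by (auto simp: is_congruence_def is_algebra_def equiv_def refl_on_def sym_def trans_def)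
  then have sub: "\<Inter>?C \<subseteq> carrier A \<times> carrier A" by blast
  have eq: "equiv (carrier A) \<theta>" if "\<theta> \<in> ?C" for \<theta>
    using that by (simp add: is_congruence_def)
  have "equiv (carrier A) (\<Inter>?C)"
  proof (rule equivI)
    show "\<Inter>?C \<subseteq> carrier A \<times> carrier A" by (rule sub)
    show "refl_on (carrier A) (\<Inter>?C)"
      using eq by (auto simp: equiv_def refl_on_def)
    show "sym (\<Inter>?C)"
      by (rule symI) (use eq in \<open>auto simp: equiv_def dest: symD\<close>)
    show "trans (\<Inter>?C)"
    proof (intro transI InterI)
      fix x y z \<theta> assume "(x, y) \<in> \<Inter>?C" "(y, z) \<in> \<Inter>?C" and \<theta>: "\<theta> \<in> ?C"
      then have "(x, y) \<in> \<theta>" "(y, z) \<in> \<theta>" by blast+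
      then show "(x, z) \<in> \<theta>" by (rule equiv_trans[OF eq[OF \<theta>]])
    qed
  qed
  moreover have "(oper A g xs, oper A g ys) \<in> \<Inter>?C"
    if "g \<in> symbols \<tau>" "xs \<in> tuples (carrier A) (arity \<tau> g)" "ys \<in> tuples (carrier A) (arity \<tau> g)"
      "list_all2 (\<lambda>x y. (x, y) \<in> \<Inter>?C) xs ys" for g xs ys
  proof
    fix \<theta> assume \<theta>: "\<theta> \<in> ?C"
    with that(4) have "list_all2 (\<lambda>x y. (x, y) \<in> \<theta>) xs ys"
      by (auto elim!: list_all2_mono)
    with \<theta> that show "(oper A g xs, oper A g ys) \<in> \<theta>"
      by (simp add: is_congruence_def)
  qed
  ultimately show ?thesis by (simp add: is_congruence_def principal_cong_def)
qed

lemma principal_cong_subset: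
  "is_congruence \<tau> A \<theta> \<Longrightarrow> (a, b) \<in> \<theta> \<Longrightarrow> principal_cong \<tau> A a b \<subseteq> \<theta>"
  by (auto simp: principal_cong_def)

lemma principal_cong_mem: "(a, b) \<in> principal_cong \<tau> A a b"
  by (auto simp: principal_cong_def)

text \<open>The quotient operation collects the classes obtained from all choices of
  representatives. Compatibility makes these classes coincide, and by reflexivity \<open>xs\<close>
  itself is an admissible choice, so the union is over a nonempty family.\<close>

lemma oper_quotient_alg:
  assumes \<theta>: "is_congruence \<tau> A \<theta>" and g: "g \<in> symbols \<tau>"
    and xs: "xs \<in> tuples (carrier A) (arity \<tau> g)"
  shows "oper (quotient_alg A \<theta>) g (map (\<lambda>x. \<theta> `` {x}) xs) = \<theta> `` {oper A g xs}"
proof -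
  have eq: "equiv (carrier A) \<theta>" using \<theta> by (simp add: is_congruence_def)
  let ?rel = "list_all2 (\<lambda>x y. (x, y) \<in> \<theta>)"
  have cls: "\<theta> `` {oper A g ys} = \<theta> `` {oper A g xs}" if "?rel xs ys" for ys
  proof -
    have "y \<in> carrier A" if "y \<in> set ys" for y
    proof -
      from \<open>?rel xs ys\<close> that obtain x where "(x, y) \<in> \<theta>" by (rule list_all2_set2E)
      then show ?thesis using equiv_type[OF eq] by blast
    qed
    then have "ys \<in> tuples (carrier A) (arity \<tau> g)"
      using xs list_all2_lengthD[OF that] by (auto simp: tuples_def)
    then have "(oper A g xs, oper A g ys) \<in> \<theta>" using \<theta> g xs that by (simp add: is_congruence_def)
    then show ?thesis by (rule equiv_class_eq[OF eq, symmetric])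
  qed
  have "list_all2 (\<in>) ys (map (\<lambda>x. \<theta> `` {x}) xs) \<longleftrightarrow> ?rel xs ys" for ys
    by (auto simp: list_all2_conv_all_nth)
  then have "oper (quotient_alg A \<theta>) g (map (\<lambda>x. \<theta> `` {x}) xs) =
      (\<Union>ys\<in>{ys. ?rel xs ys}. \<theta> `` {oper A g ys})"
    by (auto simp: quotient_alg_def)
  also have "\<dots> = (\<Union>ys\<in>{ys. ?rel xs ys}. \<theta> `` {oper A g xs})"
    using cls by (intro SUP_cong) auto
  also have "\<dots> = \<theta> `` {oper A g xs}"
  proof -
    have "?rel xs xs" using xs eq by (auto simp: tuples_def list_all2_same equiv_def refl_on_def)
    then show ?thesis by blast
  qed
  finally show ?thesis .
qed

lemma is_algebra_quotient_alg:
  assumes A: "is_algebra \<tau> A" and \<theta>: "is_congruence \<tau> A \<theta>"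
  shows "is_algebra \<tau> (quotient_alg A \<theta>)"
proof -
  have "oper (quotient_alg A \<theta>) g Xs \<in> carrier A // \<theta>"
    if g: "g \<in> symbols \<tau>" and Xs: "Xs \<in> tuples (carrier A // \<theta>) (arity \<tau> g)" for g Xs
  proof -
    have "\<forall>X\<in>set Xs. \<exists>x\<in>carrier A. X = \<theta> `` {x}"
      using Xs by (auto simp: tuples_def elim!: quotientE)
    then obtain r where r: "\<forall>X\<in>set Xs. r X \<in> carrier A \<and> X = \<theta> `` {r X}" by metis
    then have "Xs = map (\<lambda>x. \<theta> `` {x}) (map r Xs)" by (simp add: map_idI)
    moreover have "map r Xs \<in> tuples (carrier A) (arity \<tau> g)"
      using Xs r by (auto simp: tuples_def)
    ultimately have "oper (quotient_alg A \<theta>) g Xs = \<theta> `` {oper A g (map r Xs)}"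
      and "oper A g (map r Xs) \<in> carrier A"
      using oper_quotient_alg[OF \<theta> g, of "map r Xs"] A g by (auto simp: is_algebra_def)
    then show ?thesis by (simp add: quotientI)
  qed
  then show ?thesis
    using A by (auto simp: is_algebra_def quotient_alg_def quotient_def)
qed

lemma is_algebra_product_alg:
  assumes "\<And>i. i \<in> I \<Longrightarrow> is_algebra \<tau> (A i)"
  shows "is_algebra \<tau> (product_alg I A)"
proof -
  have "oper (A i) g (map (\<lambda>f. f i) fs) \<in> carrier (A i)"
    if "i \<in> I" "g \<in> symbols \<tau>" "fs \<in> tuples (\<Pi>\<^sub>E i\<in>I. carrier (A i)) (arity \<tau> g)" for i g fs
  proof -
    have "map (\<lambda>f. f i) fs \<in> tuples (carrier (A i)) (arity \<tau> g)"
      using that by (auto simp: tuples_def)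
    then show ?thesis using assms that by (simp add: is_algebra_def)
  qed
  moreover have "(\<Pi>\<^sub>E i\<in>I. carrier (A i)) \<noteq> {}"
    using assms by (simp add: PiE_eq_empty_iff is_algebra_def)
  ultimately show ?thesis by (auto simp: is_algebra_def product_alg_def)
qed

text \<open>The canonical map into a product of quotients is always a homomorphism, so centrality
  reduces to its bijectivity.\<close>

lemma alg_iso_product_quotient:
  assumes A: "is_algebra \<tau> A" and \<theta>: "\<And>i. i \<in> I \<Longrightarrow> is_congruence \<tau> A (\<theta> i)"
    and bij: "bij_betw (\<lambda>u. \<lambda>i\<in>I. \<theta> i `` {u}) (carrier A) (\<Pi>\<^sub>E i\<in>I. carrier A // \<theta> i)"
  shows "alg_iso \<tau> A (product_alg I (\<lambda>i. quotient_alg A (\<theta> i))) (\<lambda>u. \<lambda>i\<in>I. \<theta> i `` {u})"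
proof -
  have "is_algebra \<tau> (product_alg I (\<lambda>i. quotient_alg A (\<theta> i)))"
    by (intro is_algebra_product_alg is_algebra_quotient_alg A \<theta>)
  moreover have "(\<lambda>i\<in>I. \<theta> i `` {oper A g xs}) =
      oper (product_alg I (\<lambda>i. quotient_alg A (\<theta> i))) g (map (\<lambda>u. \<lambda>i\<in>I. \<theta> i `` {u}) xs)"
    if "g \<in> symbols \<tau>" "xs \<in> tuples (carrier A) (arity \<tau> g)" for g xs
    using oper_quotient_alg[OF \<theta> that]
    by (auto simp: product_alg_def comp_def intro!: restrict_ext)
  moreover have "carrier (product_alg I (\<lambda>i. quotient_alg A (\<theta> i))) = (\<Pi>\<^sub>E i\<in>I. carrier A // \<theta> i)"
    by (simp add: product_alg_def quotient_alg_def)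
  ultimately show ?thesis using A bij by (simp add: alg_iso_def)
qed


section \<open>Vectors over a Boolean algebra, evaluated at ultrafilters\<close>

abbreviation boolean_vectors :: "'e set \<Rightarrow> ('r::boolean_algebra, 'e \<Rightarrow> 'r) module" where
  "boolean_vectors \<equiv> free_semimodule boolean_semiring"

lemma carrier_boolean_vectors:
  "carrier (boolean_vectors E) = {v. (\<forall>d. d \<notin> E \<longrightarrow> v d = bot) \<and> finite {d. v d \<noteq> bot}}"
  by (simp add: free_semimodule_def boolean_semiring_def)

lemma boolean_vectors_simps:
  "\<zero>\<^bsub>boolean_vectors E\<^esub> = (\<lambda>d. bot)"
  "v \<oplus>\<^bsub>boolean_vectors E\<^esub> w = (\<lambda>d. sup (v d) (w d))"
  "r \<odot>\<^bsub>boolean_vectors E\<^esub> v = (\<lambda>d. inf r (v d))"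
  "unit_vec boolean_semiring e = (\<lambda>d. if d = e then Orderings.top else bot)"
  by (simp_all add: free_semimodule_def boolean_semiring_def unit_vec_def cong: if_cong)

lemma boolean_vectors_add_closed:
  assumes "v \<in> carrier (boolean_vectors E)" "w \<in> carrier (boolean_vectors E)"
  shows "(\<lambda>d. sup (v d) (w d)) \<in> carrier (boolean_vectors E)"
proof -
  have "finite ({d. v d \<noteq> bot} \<union> {d. w d \<noteq> bot})"
    using assms by (simp add: carrier_boolean_vectors)
  then have "finite {d. sup (v d) (w d) \<noteq> bot}"
    by (rule rev_finite_subset) auto
  then show ?thesis using assms by (simp add: carrier_boolean_vectors)
qed

lemma boolean_vectors_smult_closed:
  assumes "v \<in> carrier (boolean_vectors E)"
  shows "(\<lambda>d. inf r (v d)) \<in> carrier (boolean_vectors E)"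
proof -
  have "finite {d. v d \<noteq> bot}"
    using assms by (simp add: carrier_boolean_vectors)
  then have "finite {d. inf r (v d) \<noteq> bot}"
    by (rule rev_finite_subset) auto
  then show ?thesis using assms by (simp add: carrier_boolean_vectors)
qed

lemma unit_vec_closed:
  "e \<in> E \<Longrightarrow> unit_vec boolean_semiring e \<in> carrier (boolean_vectors E)"
  by (auto simp: carrier_boolean_vectors boolean_vectors_simps intro: finite_subset[of _ "{e}"])

lemma zero_vec_closed: "(\<lambda>d. bot) \<in> carrier (boolean_vectors E)"
  by (simp add: carrier_boolean_vectors)

lemma unit_vec_in_ultrafilter:
  "ultrafilter F \<Longrightarrow> unit_vec boolean_semiring e d \<in> F \<longleftrightarrow> d = e"
  by (simp add: boolean_vectors_simps)

lemma boolean_vector_eqI: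
  assumes "\<And>F d. ultrafilter F \<Longrightarrow> u d \<in> F \<longleftrightarrow> w d \<in> F"
  shows "u = (w :: 'e \<Rightarrow> 'r::boolean_algebra)"
  by (rule ext, rule eq_if_same_ultrafilters) (rule assms)

lemma boolean_vector_mem:
  "v \<in> carrier (boolean_vectors E) \<Longrightarrow> ultrafilter F \<Longrightarrow> v d \<in> F \<Longrightarrow> d \<in> E"
  by (auto simp: carrier_boolean_vectors)

lemma abelian_monoid_boolean_vectors:
  "abelian_monoid (boolean_vectors E :: ('r::boolean_algebra, 'e \<Rightarrow> 'r) module)"
  by (rule abelian_monoidI)
    (auto simp: boolean_vectors_simps boolean_vectors_add_closed zero_vec_closed ac_simps)

text \<open>Sums are finite joins in each coordinate, and an ultrafilter contains a finite join iff
  it contains one of the joined elements. This turns sums into existential statements.\<close>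

lemma finsum_boolean_vectors:
  fixes f :: "'i \<Rightarrow> 'e \<Rightarrow> 'r::boolean_algebra"
  assumes "finite A" "f \<in> A \<rightarrow> carrier (boolean_vectors E)"
  shows "finsum (boolean_vectors E) f A \<in> carrier (boolean_vectors E)"
    and "ultrafilter F \<Longrightarrow> finsum (boolean_vectors E) f A d \<in> F \<longleftrightarrow> (\<exists>a\<in>A. f a d \<in> F)"
proof -
  interpret abelian_monoid "boolean_vectors E :: ('r, 'e \<Rightarrow> 'r) module"
    by (rule abelian_monoid_boolean_vectors)
  show "finsum (boolean_vectors E) f A \<in> carrier (boolean_vectors E)"
    using assms(2) by (rule finsum_closed)
  show "finsum (boolean_vectors E) f A d \<in> F \<longleftrightarrow> (\<exists>a\<in>A. f a d \<in> F)" if "ultrafilter F"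
    using assms
  proof (induction A)
    case empty
    then show ?case using that by (simp add: boolean_vectors_simps)
  next
    case (insert x A)
    then show ?case
      using that by (simp add: boolean_vectors_simps ultrafilter_sup Pi_iff)
  qed
qed

section \<open>Lifted operations and the operations \<open>q\<close> at an ultrafilter\<close>

lemma coord_prod_in_ultrafilter:
  assumes F: "ultrafilter F" and "length vs = length ds"
  shows "coord_prod boolean_semiring vs ds \<in> F \<longleftrightarrow> list_all2 (\<lambda>v d. v d \<in> F) vs ds"
  using assms(2)
proof (induction rule: list_induct2)
  case Nil
  then show ?case using F by (simp add: coord_prod_def boolean_semiring_def)
next
  case (Cons v vs d ds)
  then show ?case using F by (simp add: coord_prod_def boolean_semiring_def ultrafilter_inf)
qed

text \<open>Read a vector at \<open>F\<close> as the set of all \<open>d\<close> with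
  \<open>v d \<in> F\<close>. The lifted operation then becomes \<open>g\<close> applied elementwise
  to sets: meets turn into simultaneous membership and joins into the choice of a tuple
  \<open>ds\<close>.\<close>

lemma lifted_op_boolean:
  fixes E :: "('g, 'e) ualgebra" and vs :: "('e \<Rightarrow> 'r::boolean_algebra) list"
  assumes E: "is_algebra \<tau> E" and g: "g \<in> symbols \<tau>"
    and vs: "vs \<in> tuples (carrier (boolean_vectors (carrier E))) (arity \<tau> g)"
  shows "lifted_op boolean_semiring E g vs \<in> carrier (boolean_vectors (carrier E))"
    and "ultrafilter F \<Longrightarrow> lifted_op boolean_semiring E g vs d \<in> F \<longleftrightarrow>
      (\<exists>ds. list_all2 (\<lambda>v d. v d \<in> F) vs ds \<and> d = oper E g ds)"
proof -
  let ?c = "coord_prod boolean_semiring vs"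
  let ?A = "{ds \<in> tuples (carrier E) (length vs). ?c ds \<noteq> \<zero>\<^bsub>boolean_semiring\<^esub>}"
  let ?f = "\<lambda>ds. ?c ds \<odot>\<^bsub>boolean_vectors (carrier E)\<^esub> unit_vec boolean_semiring (oper E g ds)"
  have V: "v \<in> carrier (boolean_vectors (carrier E))" if "v \<in> set vs" for v
    using vs that by (auto simp: tuples_def)
  have len: "length vs = arity \<tau> g" using vs by (simp add: tuples_def)
  let ?S = "\<Union>v\<in>set vs. {d. v d \<noteq> bot}"
  \<comment> \<open>A nonzero coefficient lies in some ultrafilter, which then contains each of its
    factors. Hence every entry of \<open>ds\<close> comes from one of the finite supports, and the
    index set of the sum is finite.\<close>
  have "?A \<subseteq> {ds. set ds \<subseteq> ?S \<and> length ds = length vs}"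
  proof
    fix ds assume ds: "ds \<in> ?A"
    then have l: "length vs = length ds" and "?c ds \<noteq> bot"
      by (auto simp: tuples_def boolean_semiring_def)
    then obtain G where G: "ultrafilter G" "?c ds \<in> G" using ultrafilter_containing[of "?c ds"] by auto
    then have rel: "list_all2 (\<lambda>v d. v d \<in> G) vs ds" using l by (simp add: coord_prod_in_ultrafilter)
    have "set ds \<subseteq> ?S"
    proof
      fix d assume "d \<in> set ds"
      with rel obtain v where "v \<in> set vs" "v d \<in> G" by (rule list_all2_set2E)
      then show "d \<in> ?S" using ultrafilter_bot[OF G(1)] by (intro UN_I[of v]) auto
    qed
    with l show "ds \<in> {ds. set ds \<subseteq> ?S \<and> length ds = length vs}" by simp
  qed
  moreover have "finite ?S"
  proof (rule finite_UN_I)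
    show "finite {d. v d \<noteq> bot}" if "v \<in> set vs" for v
      using V[OF that] by (simp add: carrier_boolean_vectors)
  qed simp
  ultimately have fin: "finite ?A"
    using finite_lists_length_eq[of ?S "length vs"] finite_subset by blast
  have op: "oper E g ds \<in> carrier E" if "ds \<in> tuples (carrier E) (length vs)" for ds
    using that E g len by (simp add: is_algebra_def)
  have f: "?f \<in> ?A \<rightarrow> carrier (boolean_vectors (carrier E))"
    unfolding boolean_vectors_simps(3)
    by (intro funcsetI boolean_vectors_smult_closed unit_vec_closed op) simp
  show "lifted_op boolean_semiring E g vs \<in> carrier (boolean_vectors (carrier E))"
    unfolding lifted_op_def using fin f by (rule finsum_boolean_vectors)
  show "lifted_op boolean_semiring E g vs d \<in> F \<longleftrightarrow>
      (\<exists>ds. list_all2 (\<lambda>v d. v d \<in> F) vs ds \<and> d = oper E g ds)" if F: "ultrafilter F"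
  proof -
    \<comment> \<open>The index set \<open>?A\<close> loses no tuple relevant at \<open>F\<close>: a
      coefficient in \<open>F\<close> is not \<open>bot\<close>, and a coordinate in
      \<open>F\<close> is nonzero, so its index lies in \<open>carrier E\<close>.\<close>
    have *: "ds \<in> ?A \<and> ?f ds d \<in> F \<longleftrightarrow> list_all2 (\<lambda>v d. v d \<in> F) vs ds \<and> d = oper E g ds" for ds
    proof (cases "length ds = length vs")
      case True
      have "set ds \<subseteq> carrier E" if "list_all2 (\<lambda>v d. v d \<in> F) vs ds"
      proof
        fix d assume "d \<in> set ds"
        with that obtain v where v: "v \<in> set vs" "v d \<in> F" by (rule list_all2_set2E)
        from V[OF v(1)] F v(2) show "d \<in> carrier E" by (rule boolean_vector_mem)
      qed
      moreover have "?c ds \<noteq> bot" if "?c ds \<in> F" using F that by auto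
      moreover have "?c ds \<in> F \<longleftrightarrow> list_all2 (\<lambda>v d. v d \<in> F) vs ds"
        using coord_prod_in_ultrafilter[OF F] True by metis
      moreover have "?f ds d \<in> F \<longleftrightarrow> ?c ds \<in> F \<and> d = oper E g ds"
        using F by (simp add: boolean_vectors_simps(3) ultrafilter_inf unit_vec_in_ultrafilter)
      moreover have "ds \<in> ?A \<longleftrightarrow> set ds \<subseteq> carrier E \<and> ?c ds \<noteq> bot"
        using True by (auto simp: tuples_def boolean_semiring_def)
      ultimately show ?thesis by blast
    qed (auto simp: tuples_def dest: list_all2_lengthD)
    show ?thesis
      unfolding lifted_op_def finsum_boolean_vectors(2)[OF fin f F] using * by blast
  qed
qed

lemma enum_of: "finite I \<Longrightarrow> distinct (enum_of I) \<and> set (enum_of I) = I"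
  unfolding enum_of_def by (rule someI_ex) (metis finite_distinct_list)

lemma q_op_boolean:
  assumes "length ws = card I" "set ws \<subseteq> carrier (boolean_vectors E)"
  shows "q_op boolean_semiring E I v ws \<in> carrier (boolean_vectors E)"
    and "ultrafilter F \<Longrightarrow> q_op boolean_semiring E I v ws d \<in> F \<longleftrightarrow>
      (\<exists>i<card I. v (enum_of I ! i) \<in> F \<and> (ws ! i) d \<in> F)"
proof -
  let ?f = "\<lambda>i. v (enum_of I ! i) \<odot>\<^bsub>boolean_vectors E\<^esub> (ws ! i)"
  have f: "?f \<in> {..<card I} \<rightarrow> carrier (boolean_vectors E)"
    using assms by (auto simp: boolean_vectors_simps(3) intro!: boolean_vectors_smult_closed)
  show "q_op boolean_semiring E I v ws \<in> carrier (boolean_vectors E)"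
    unfolding q_op_def by (rule finsum_boolean_vectors[OF _ f]) simp
  show "q_op boolean_semiring E I v ws d \<in> F \<longleftrightarrow>
      (\<exists>i<card I. v (enum_of I ! i) \<in> F \<and> (ws ! i) d \<in> F)" if "ultrafilter F"
    unfolding q_op_def finsum_boolean_vectors(2)[OF finite_lessThan f that]
    using that by (auto simp: boolean_vectors_simps(3) ultrafilter_inf)
qed

text \<open>Indexing the arguments by the elements of \<open>I\<close> removes the arbitrary
  enumeration from all later arguments: position \<open>i\<close> of the list belongs to the element
  \<open>enum_of I ! i\<close>.\<close>

lemma q_op_boolean_map:
  assumes "finite I" "\<And>e. e \<in> I \<Longrightarrow> ws e \<in> carrier (boolean_vectors E)"
  shows "q_op boolean_semiring E I v (map ws (enum_of I)) \<in> carrier (boolean_vectors E)"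
    and "ultrafilter F \<Longrightarrow> q_op boolean_semiring E I v (map ws (enum_of I)) d \<in> F \<longleftrightarrow>
      (\<exists>e\<in>I. v e \<in> F \<and> ws e d \<in> F)"
proof -
  have len: "length (enum_of I) = card I" and set: "set (enum_of I) = I"
    using enum_of[OF assms(1)] distinct_card by fastforce+
  then have *: "length (map ws (enum_of I)) = card I"
    "set (map ws (enum_of I)) \<subseteq> carrier (boolean_vectors E)" using assms(2) by auto
  show "q_op boolean_semiring E I v (map ws (enum_of I)) \<in> carrier (boolean_vectors E)"
    using * by (rule q_op_boolean)
  show "q_op boolean_semiring E I v (map ws (enum_of I)) d \<in> F \<longleftrightarrow>
      (\<exists>e\<in>I. v e \<in> F \<and> ws e d \<in> F)" if "ultrafilter F"
  proof -
    have "(\<exists>i<card I. v (enum_of I ! i) \<in> F \<and> (map ws (enum_of I) ! i) d \<in> F) \<longleftrightarrow>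
        (\<exists>e\<in>set (enum_of I). v e \<in> F \<and> ws e d \<in> F)"
      using len by (auto simp: Bex_def in_set_conv_nth)
    then show ?thesis unfolding q_op_boolean(2)[OF * that] set .
  qed
qed

section \<open>The algebra of vectors and its congruences\<close>

lemma carrier_vec_alg: "carrier (vec_alg R E) = carrier (free_semimodule R (carrier E))"
  by (simp add: vec_alg_def Let_def)

lemma oper_vec_alg:
  "oper (vec_alg boolean_semiring E) VZero vs = (\<lambda>d. bot)"
  "oper (vec_alg boolean_semiring E) VAdd vs = (\<lambda>d. sup ((vs ! 0) d) ((vs ! 1) d))"
  "oper (vec_alg boolean_semiring E) (VScale r) vs = (\<lambda>d. inf r ((vs ! 0) d))"
  "oper (vec_alg boolean_semiring E) (VLift g) vs = lifted_op boolean_semiring E g vs"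
  "oper (vec_alg boolean_semiring E) (VQ I) vs = q_op boolean_semiring (carrier E) I (hd vs) (tl vs)"
  "oper (vec_alg boolean_semiring E) (VConst e) vs = unit_vec boolean_semiring e"
  by (simp_all add: vec_alg_def Let_def boolean_vectors_simps(1-3))

text \<open>A case rule that distinguishes the kinds of symbols and at the same time unpacks the
  argument list according to the arity.\<close>

lemma vec_sig_cases:
  fixes E :: "('g, 'e) ualgebra"
  assumes "s \<in> symbols (vec_sig \<tau> (boolean_semiring :: 'r::boolean_algebra ring) E)"
    and "vs \<in> tuples X (arity (vec_sig \<tau> (boolean_semiring :: 'r ring) E) s)"
  obtains (Zero) "s = VZero" "vs = []"
  | (Add) v w where "s = VAdd" "vs = [v, w]" "v \<in> X" "w \<in> X"
  | (Scale) r v where "s = VScale r" "vs = [v]" "v \<in> X"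
  | (Lift) g where "s = VLift g" "g \<in> symbols \<tau>" "vs \<in> tuples X (arity \<tau> g)"
  | (Q) I v ws where "s = VQ I" "finite I" "I \<noteq> {}" "I \<subseteq> carrier E" "vs = v # ws" "v \<in> X"
      "length ws = card I" "set ws \<subseteq> X"
  | (Const) e where "s = VConst e" "e \<in> carrier E" "vs = []"
proof (cases s)
  case (VQ I)
  then have "finite I" "I \<noteq> {}" "I \<subseteq> carrier E" "length vs = Suc (card I)" "set vs \<subseteq> X"
    using assms by (auto simp: vec_sig_def tuples_def)
  moreover from this obtain v ws where "vs = v # ws" by (cases vs) auto
  ultimately show thesis using VQ that(5)[of I v ws] by simp
next
  case VAdd
  then show thesis using assms that(2)
    by (auto simp: vec_sig_def tuples_def length_Suc_conv numeral_2_eq_2)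
next
  case (VScale r)
  then show thesis using assms that(3)
    by (auto simp: vec_sig_def tuples_def length_Suc_conv)
qed (use assms that(1,4,6) in \<open>auto simp: vec_sig_def tuples_def\<close>)

lemma is_algebra_vec_alg:
  fixes E :: "('g, 'e) ualgebra"
  assumes E: "is_algebra \<tau> E"
  shows "is_algebra (vec_sig \<tau> (boolean_semiring :: 'r::boolean_algebra ring) E)
    (vec_alg boolean_semiring E)"
proof -
  let ?\<sigma> = "vec_sig \<tau> (boolean_semiring :: 'r ring) E"
  let ?V = "boolean_vectors (carrier E) :: ('r, 'e \<Rightarrow> 'r) module"
  have "oper (vec_alg boolean_semiring E) s vs \<in> carrier ?V"
    if s: "s \<in> symbols ?\<sigma>" "vs \<in> tuples (carrier ?V) (arity ?\<sigma> s)" for s vs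
    using s
  proof (cases rule: vec_sig_cases)
    case (Lift g)
    then show ?thesis using lifted_op_boolean(1)[OF E] by (simp add: oper_vec_alg)
  next
    case (Q I v ws)
    then show ?thesis using q_op_boolean(1) by (simp add: oper_vec_alg)
  next
    case (Const e)
    then show ?thesis using unit_vec_closed by (simp add: oper_vec_alg)
  qed (auto simp: oper_vec_alg zero_vec_closed
      boolean_vectors_add_closed boolean_vectors_smult_closed)
  then show ?thesis
    using zero_vec_closed by (auto simp: is_algebra_def carrier_vec_alg)
qed

text \<open>Whether a coordinate of a result lies in \<open>F\<close> depends only on which
  coordinates of the arguments lie in \<open>F\<close>. Agreement on any set of ultrafilters is
  therefore compatible with all operations; here it is the clopen set belonging to
  \<open>a\<close>.\<close>

lemma is_congruence_below:
  fixes E :: "('g, 'e) ualgebra" and a :: "'r::boolean_algebra"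
  assumes E: "is_algebra \<tau> E"
  defines "V \<equiv> carrier (boolean_vectors (carrier E))"
  shows "is_congruence (vec_sig \<tau> boolean_semiring E) (vec_alg boolean_semiring E)
    {(u, w). u \<in> V \<and> w \<in> V \<and> (\<forall>F. ultrafilter F \<and> a \<in> F \<longrightarrow> (\<forall>d. u d \<in> F \<longleftrightarrow> w d \<in> F))}"
    (is "is_congruence ?\<sigma> ?A ?\<theta>")
proof -
  have "equiv V ?\<theta>"
    by (auto simp: equiv_def refl_on_def sym_def trans_def)
  moreover have "(oper ?A s us, oper ?A s ws) \<in> ?\<theta>"
    if s: "s \<in> symbols ?\<sigma>" and us: "us \<in> tuples V (arity ?\<sigma> s)" and ws: "ws \<in> tuples V (arity ?\<sigma> s)"
      and rel: "list_all2 (\<lambda>u w. (u, w) \<in> ?\<theta>) us ws" for s us ws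
  proof -
    have "oper ?A s us \<in> V" "oper ?A s ws \<in> V"
      using is_algebra_vec_alg[OF E] s us ws by (auto simp: is_algebra_def carrier_vec_alg V_def)
    moreover have "oper ?A s us d \<in> F \<longleftrightarrow> oper ?A s ws d \<in> F" if F: "ultrafilter F" "a \<in> F" for F d
    proof -
      have nth: "(us ! i) d \<in> F \<longleftrightarrow> (ws ! i) d \<in> F" if "i < length us" for i d
        using rel F that by (auto simp: list_all2_conv_all_nth)
      have len: "length us = length ws" using rel by (rule list_all2_lengthD)
      from s us show ?thesis
      proof (cases rule: vec_sig_cases)
        case (Add v w)
        then show ?thesis using nth[of 0 d] nth[of 1 d] F(1)
          by (simp add: oper_vec_alg ultrafilter_sup)
      next
        case (Scale r v)
        then show ?thesis using nth[of 0 d] F(1)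
          by (simp add: oper_vec_alg ultrafilter_inf)
      next
        case (Lift g)
        have "list_all2 (\<lambda>v d. v d \<in> F) us ds \<longleftrightarrow> list_all2 (\<lambda>v d. v d \<in> F) ws ds" for ds
          using nth len by (auto simp: list_all2_conv_all_nth)
        moreover have "ws \<in> tuples V (arity \<tau> g)" using Lift us ws by (simp add: tuples_def)
        ultimately show ?thesis
          using Lift lifted_op_boolean(2)[OF E _ _ F(1)] by (simp add: oper_vec_alg V_def)
      next
        case (Q I v us')
        from s ws Q(1) obtain w ws' where w: "ws = w # ws'" "length ws' = card I" "set ws' \<subseteq> V"
          by (cases rule: vec_sig_cases) auto
        have "v e \<in> F \<longleftrightarrow> w e \<in> F" for e using nth[of 0] Q w by simp
        moreover have "(us' ! i) d \<in> F \<longleftrightarrow> (ws' ! i) d \<in> F" if "i < card I" for i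
          using nth[of "Suc i"] Q w that by simp
        ultimately have "(\<exists>i<card I. v (enum_of I ! i) \<in> F \<and> (us' ! i) d \<in> F) \<longleftrightarrow>
            (\<exists>i<card I. w (enum_of I ! i) \<in> F \<and> (ws' ! i) d \<in> F)"
          by auto
        moreover have "oper ?A s us d \<in> F \<longleftrightarrow> (\<exists>i<card I. v (enum_of I ! i) \<in> F \<and> (us' ! i) d \<in> F)"
          using Q(1,5) q_op_boolean(2)[OF Q(7) Q(8)[unfolded V_def] F(1)] by (simp add: oper_vec_alg)
        moreover have "oper ?A s ws d \<in> F \<longleftrightarrow> (\<exists>i<card I. w (enum_of I ! i) \<in> F \<and> (ws' ! i) d \<in> F)"
          using Q(1) w(1) q_op_boolean(2)[OF w(2) w(3)[unfolded V_def] F(1)] by (simp add: oper_vec_alg)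
        ultimately show ?thesis by simp
      qed (simp_all add: oper_vec_alg)
    qed
    ultimately show ?thesis by blast
  qed
  ultimately show ?thesis by (simp add: is_congruence_def carrier_vec_alg V_def)
qed

text \<open>Modulo any congruence identifying \<open>v\<close> with \<open>e\<close>, \<open>q\<^sub>I(v, -)\<close> is the projection to
  the coordinate \<open>e\<close>.\<close>
lemma q_op_congruent:
  fixes E :: "('g, 'e) ualgebra" and v :: "'e \<Rightarrow> 'r::boolean_algebra"
  assumes \<theta>: "is_congruence (vec_sig \<tau> boolean_semiring E) (vec_alg boolean_semiring E) \<theta>"
    and ve: "(v, unit_vec boolean_semiring e) \<in> \<theta>"
    and I: "finite I" "I \<subseteq> carrier E" "e \<in> I"
    and ws: "\<And>e. e \<in> I \<Longrightarrow> ws e \<in> carrier (boolean_vectors (carrier E))"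
  shows "(q_op boolean_semiring (carrier E) I v (map ws (enum_of I)), ws e) \<in> \<theta>"
proof -
  let ?V = "carrier (boolean_vectors (carrier E)) :: ('e \<Rightarrow> 'r) set"
  let ?u = "unit_vec boolean_semiring e :: 'e \<Rightarrow> 'r"
  let ?\<sigma> = "vec_sig \<tau> (boolean_semiring :: 'r ring) E"
  have eq: "equiv ?V \<theta>" using \<theta> by (simp add: is_congruence_def carrier_vec_alg)
  then have V: "v \<in> ?V" "?u \<in> ?V" using ve equiv_type by blast+
  have len: "length (enum_of I) = card I" and set: "set (enum_of I) = I"
    using enum_of[OF I(1)] distinct_card by fastforce+
  have "list_all2 (\<lambda>x y. (x, y) \<in> \<theta>) (map ws (enum_of I)) (map ws (enum_of I))"
    using eq ws set by (auto simp: list_all2_same list.rel_map equiv_def refl_on_def)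
  then have "list_all2 (\<lambda>x y. (x, y) \<in> \<theta>) (v # map ws (enum_of I)) (?u # map ws (enum_of I))"
    using ve by simp
  moreover have "x # map ws (enum_of I) \<in> tuples ?V (arity ?\<sigma> (VQ I))" if "x \<in> ?V" for x
    using that len set ws by (auto simp: tuples_def vec_sig_def)
  moreover have "VQ I \<in> symbols ?\<sigma>" using I by (auto simp: vec_sig_def)
  ultimately have "(oper (vec_alg boolean_semiring E) (VQ I) (v # map ws (enum_of I)),
      oper (vec_alg boolean_semiring E) (VQ I) (?u # map ws (enum_of I))) \<in> \<theta>"
    using \<theta> V by (simp add: is_congruence_def carrier_vec_alg)
  \<comment> \<open>With the unit vector of \<open>e\<close> as first argument a single summand
    survives, so the projection is exact and not merely modulo \<open>\<theta>\<close>.\<close>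
  moreover have "q_op boolean_semiring (carrier E) I ?u (map ws (enum_of I)) = ws e"
    using I(3) by (intro boolean_vector_eqI)
      (auto simp: q_op_boolean_map(2)[OF I(1) ws] unit_vec_in_ultrafilter)
  ultimately show ?thesis by (simp add: oper_vec_alg)
qed

lemma vec_cong_boolean:
  fixes E :: "('g, 'e) ualgebra" and v :: "'e \<Rightarrow> 'r::boolean_algebra"
  assumes "is_algebra \<tau> E" "v \<in> carrier (boolean_vectors (carrier E))" "e \<in> carrier E"
  shows "is_congruence (vec_sig \<tau> boolean_semiring E) (vec_alg boolean_semiring E)
      (vec_cong \<tau> boolean_semiring E v e)"
    and "(v, unit_vec boolean_semiring e) \<in> vec_cong \<tau> boolean_semiring E v e"
  unfolding vec_cong_def using assms
  by (auto intro!: is_congruence_principal_cong is_algebra_vec_alg principal_cong_mem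
      simp: carrier_vec_alg unit_vec_closed)


section \<open>Finitely central vectors are partitions of unity\<close>

text \<open>Injectivity of the canonical map makes vectors equal once they are congruent modulo
  \<open>\<theta>(v, e)\<close> for every \<open>e \<in> I\<close>. Identities for \<open>q\<close>
  can thus be checked where \<open>q\<close> is a projection and then read at
  \<open>F\<close>.\<close>

lemma central_wrt_imp_partition:
  fixes E :: "('g, 'e) ualgebra" and v :: "'e \<Rightarrow> 'r::boolean_algebra"
  assumes E: "is_algebra \<tau> E" and v: "v \<in> carrier (boolean_vectors (carrier E))"
    and I: "finite I" "I \<noteq> {}" "I \<subseteq> carrier E"
    and central: "central_wrt \<tau> boolean_semiring E I v" and F: "ultrafilter F"
  shows "\<exists>!d. v d \<in> F"
proof -
  let ?V = "carrier (boolean_vectors (carrier E)) :: ('e \<Rightarrow> 'r) set"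
  let ?\<theta> = "vec_cong \<tau> boolean_semiring E v"
  define q where "q ws = q_op boolean_semiring (carrier E) I v (map ws (enum_of I))" for ws
  have \<theta>: "is_congruence (vec_sig \<tau> boolean_semiring E) (vec_alg boolean_semiring E) (?\<theta> e)"
    "(v, unit_vec boolean_semiring e) \<in> ?\<theta> e" if "e \<in> I" for e
    using vec_cong_boolean[OF E v] I that by auto
  have eq: "equiv ?V (?\<theta> e)" if "e \<in> I" for e
    using \<theta>(1)[OF that] by (simp add: is_congruence_def carrier_vec_alg)
  have inj: "u = w" if "\<And>e. e \<in> I \<Longrightarrow> (u, w) \<in> ?\<theta> e" for u w
  proof -
    have "u \<in> ?V" "w \<in> ?V" using that eq I(2) equiv_type by blast+
    moreover have "(\<lambda>e\<in>I. ?\<theta> e `` {u}) = (\<lambda>e\<in>I. ?\<theta> e `` {w})"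
      by (intro restrict_ext equiv_class_eq[OF eq that])
    ultimately show ?thesis
      using central
      by (auto simp: central_wrt_def alg_iso_def bij_betw_def carrier_vec_alg dest: inj_onD)
  qed
  have q_V: "q ws \<in> ?V" if "\<And>e. e \<in> I \<Longrightarrow> ws e \<in> ?V" for ws
    unfolding q_def using I(1) that by (rule q_op_boolean_map)
  have q_F: "q ws d \<in> F \<longleftrightarrow> (\<exists>e\<in>I. v e \<in> F \<and> ws e d \<in> F)" if "\<And>e. e \<in> I \<Longrightarrow> ws e \<in> ?V" for ws d
    unfolding q_def using I(1) that F by (rule q_op_boolean_map)
  have q_cong: "(q ws, ws e) \<in> ?\<theta> e" if "\<And>e. e \<in> I \<Longrightarrow> ws e \<in> ?V" "e \<in> I" for ws e
    unfolding q_def using \<theta>[OF that(2)] I(1,3) that(2,1) by (rule q_op_congruent)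
  have unit: "unit_vec boolean_semiring e \<in> ?V" if "e \<in> I" for e
    using that I by (intro unit_vec_closed) auto

  \<comment> \<open>Modulo \<open>\<theta>(v, e)\<close> the left side is the constant
    \<open>e\<close>, hence \<open>v\<close>. Read at \<open>F\<close>, the identity confines the
    coordinates of \<open>v\<close> lying in \<open>F\<close> to indices in
    \<open>I\<close>.\<close>
  have "q (unit_vec boolean_semiring) = v"
  proof (rule inj)
    fix e assume e: "e \<in> I"
    show "(q (unit_vec boolean_semiring), v) \<in> ?\<theta> e"
      by (rule equiv_trans_sym[OF eq[OF e] _ \<theta>(2)[OF e]], rule q_cong) (use unit e in auto)
  qed
  then have supp: "d \<in> I" if "v d \<in> F" for d
    using q_F[of "unit_vec boolean_semiring" d, OF unit] that F by (auto simp: unit_vec_in_ultrafilter)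
  obtain e0 where e0: "e0 \<in> I" using I(2) by blast
  let ?e0 = "unit_vec boolean_semiring e0 :: 'e \<Rightarrow> 'r"
  \<comment> \<open>Idempotence. Coordinate \<open>e0\<close> of the right side is the top element
    and lies in \<open>F\<close>, so some \<open>v e\<close> with \<open>e \<in> I\<close> lies in
    \<open>F\<close>.\<close>
  have "q (\<lambda>_. ?e0) = ?e0"
    by (rule inj, rule q_cong[of "\<lambda>_. ?e0", OF unit[OF e0]])
  then have ex: "\<exists>e\<in>I. v e \<in> F"
    using q_F[of "\<lambda>_. ?e0" e0, OF unit[OF e0]] F by (auto simp: unit_vec_in_ultrafilter)
  have "i = j" if i: "i \<in> I" "v i \<in> F" and j: "j \<in> I" "v j \<in> F" for i j
  proof (rule ccontr)
    assume "i \<noteq> j"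
    \<comment> \<open>A matrix of vectors whose only nonzero entry is off the diagonal, at
      \<open>(i, j)\<close>. At \<open>F\<close> the iterated \<open>q\<close> sees this entry,
      because both \<open>v i\<close> and \<open>v j\<close> lie in \<open>F\<close>, while the
      diagonal consists of zero vectors. The diagonal identity says that both results are
      equal.\<close>
    define W where "W e e' = (if e = i \<and> e' = j then ?e0 else (\<lambda>_. bot))" for e e'
    have W: "W e e' \<in> ?V" for e e'
      using unit[OF e0] by (simp add: W_def zero_vec_closed)
    have "q (\<lambda>e. q (W e)) = q (\<lambda>e. W e e)"
    proof (rule inj)
      fix e assume e: "e \<in> I"
      have "(q (\<lambda>e. q (W e)), W e e) \<in> ?\<theta> e"
        using eq[OF e] q_cong[of "\<lambda>e. q (W e)", OF q_V[OF W] e] q_cong[of "W e", OF W e]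
        by (rule equiv_trans)
      then show "(q (\<lambda>e. q (W e)), q (\<lambda>e. W e e)) \<in> ?\<theta> e"
        by (rule equiv_trans_sym[OF eq[OF e] _ q_cong[of "\<lambda>e. W e e", OF W e]])
    qed
    moreover have "q (\<lambda>e. q (W e)) e0 \<in> F"
    proof -
      have "W i j e0 \<in> F" using F by (simp add: W_def unit_vec_in_ultrafilter)
      then show ?thesis
        using q_F[of "\<lambda>e. q (W e)" e0, OF q_V[OF W]] q_F[of "W i" e0, OF W] i j by blast
    qed
    moreover have "q (\<lambda>e. W e e) e0 \<notin> F"
      using q_F[of "\<lambda>e. W e e" e0, OF W] F \<open>i \<noteq> j\<close> by (auto simp: W_def)
    ultimately show False by simp
  qed
  with ex supp show ?thesis by blast
qed

text \<open>Uniqueness of the coordinate bounds \<open>\<theta>(v, e)\<close> from above by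
  agreement on the ultrafilters containing \<open>v e\<close>; existence makes these sets of
  ultrafilters cover the space as \<open>e\<close> runs through \<open>I\<close>. \<open>I\<close>
  may be any finite subset of the carrier that includes the support.\<close>

lemma partition_imp_central_wrt:
  fixes E :: "('g, 'e) ualgebra" and v :: "'e \<Rightarrow> 'r::boolean_algebra"
  assumes E: "is_algebra \<tau> E" and v: "v \<in> carrier (boolean_vectors (carrier E))"
    and part: "\<And>F. ultrafilter F \<Longrightarrow> \<exists>!d. v d \<in> F"
    and I: "finite I" "I \<subseteq> carrier E" "{d. v d \<noteq> bot} \<subseteq> I"
  shows "central_wrt \<tau> boolean_semiring E I v"
proof -
  let ?V = "carrier (boolean_vectors (carrier E)) :: ('e \<Rightarrow> 'r) set"
  let ?\<theta> = "vec_cong \<tau> boolean_semiring E v"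
  have \<theta>: "is_congruence (vec_sig \<tau> boolean_semiring E) (vec_alg boolean_semiring E) (?\<theta> e)"
    "(v, unit_vec boolean_semiring e) \<in> ?\<theta> e" if "e \<in> I" for e
    using vec_cong_boolean[OF E v] I that by auto
  have eq: "equiv ?V (?\<theta> e)" if "e \<in> I" for e
    using \<theta>(1)[OF that] by (simp add: is_congruence_def carrier_vec_alg)
  have \<theta>_imp: "u d \<in> F \<longleftrightarrow> w d \<in> F"
    if "e \<in> I" "(u, w) \<in> ?\<theta> e" "ultrafilter F" "v e \<in> F" for e u w d F
  proof -
    let ?r = "{(u, w). u \<in> ?V \<and> w \<in> ?V \<and>
      (\<forall>F. ultrafilter F \<and> v e \<in> F \<longrightarrow> (\<forall>d. u d \<in> F \<longleftrightarrow> w d \<in> F))}"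
    \<comment> \<open>At an ultrafilter containing \<open>v e\<close> no other coordinate of
      \<open>v\<close> is a member, so \<open>v\<close> agrees there with the unit vector of
      \<open>e\<close>.\<close>
    have "(v, unit_vec boolean_semiring e) \<in> ?r"
      using v that(1) I(2) part by (auto simp: unit_vec_closed unit_vec_in_ultrafilter)
    then have "?\<theta> e \<subseteq> ?r"
      unfolding vec_cong_def by (intro principal_cong_subset is_congruence_below E)
    then show ?thesis using that by blast
  qed
  have "inj_on (\<lambda>u. \<lambda>e\<in>I. ?\<theta> e `` {u}) ?V"
  proof (rule inj_onI)
    fix u w assume u: "u \<in> ?V" "w \<in> ?V" and cls: "(\<lambda>e\<in>I. ?\<theta> e `` {u}) = (\<lambda>e\<in>I. ?\<theta> e `` {w})"
    have rel: "(u, w) \<in> ?\<theta> e" if "e \<in> I" for e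
    proof -
      have "?\<theta> e `` {u} = ?\<theta> e `` {w}" using fun_cong[OF cls, of e] that by simp
      then show ?thesis using eq_equiv_class[OF _ eq[OF that]] u by blast
    qed
    show "u = w"
    proof (rule boolean_vector_eqI)
      fix F :: "'r set" and d assume F: "ultrafilter F"
      then obtain e where e: "v e \<in> F" using part by blast
      then have "v e \<noteq> bot" using F by auto
      then have "e \<in> I" using I(3) by blast
      then show "u d \<in> F \<longleftrightarrow> w d \<in> F" using \<theta>_imp rel F e by blast
    qed
  qed
  moreover have "(\<lambda>u. \<lambda>e\<in>I. ?\<theta> e `` {u}) ` ?V = (\<Pi>\<^sub>E e\<in>I. ?V // ?\<theta> e)"
  proof (intro equalityI subsetI)
    fix X assume "X \<in> (\<lambda>u. \<lambda>e\<in>I. ?\<theta> e `` {u}) ` ?V"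
    then show "X \<in> (\<Pi>\<^sub>E e\<in>I. ?V // ?\<theta> e)" by (auto intro: quotientI)
  next
    fix X assume X: "X \<in> (\<Pi>\<^sub>E e\<in>I. ?V // ?\<theta> e)"
    then have "\<forall>e\<in>I. \<exists>w\<in>?V. X e = ?\<theta> e `` {w}" by (fastforce elim!: quotientE)
    then obtain ws where ws: "\<And>e. e \<in> I \<Longrightarrow> ws e \<in> ?V \<and> X e = ?\<theta> e `` {ws e}" by metis
    \<comment> \<open>The preimage of a tuple of classes: \<open>q\<close> applied to
      representatives is congruent to the representative \<open>ws e\<close> modulo each
      \<open>\<theta>(v, e)\<close>.\<close>
    let ?q = "q_op boolean_semiring (carrier E) I v (map ws (enum_of I))"
    have "?q \<in> ?V" using I(1) ws by (intro q_op_boolean_map) auto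
    moreover have "X e = ?\<theta> e `` {?q}" if e: "e \<in> I" for e
    proof -
      have "(?q, ws e) \<in> ?\<theta> e"
        using q_op_congruent[OF \<theta>[OF e] I(1,2) e] ws by blast
      then show ?thesis using ws[OF e] equiv_class_eq[OF eq[OF e]] by blast
    qed
    then have "X = (\<lambda>e\<in>I. ?\<theta> e `` {?q})"
      using X by (intro ext) (auto simp: PiE_def extensional_def)
    ultimately show "X \<in> (\<lambda>u. \<lambda>e\<in>I. ?\<theta> e `` {u}) ` ?V" by blast
  qed
  ultimately have "bij_betw (\<lambda>u. \<lambda>e\<in>I. ?\<theta> e `` {u}) ?V (\<Pi>\<^sub>E e\<in>I. ?V // ?\<theta> e)"
    by (simp add: bij_betw_def)
  then show ?thesis
    unfolding central_wrt_def
    by (intro alg_iso_product_quotient is_algebra_vec_alg E \<theta>) (auto simp: carrier_vec_alg)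
qed

lemma finitely_central_iff_partition:
  fixes E :: "('g, 'e) ualgebra" and v :: "'e \<Rightarrow> 'r::boolean_algebra"
  assumes E: "is_algebra \<tau> E"
  shows "finitely_central \<tau> boolean_semiring E v \<longleftrightarrow>
    v \<in> carrier (boolean_vectors (carrier E)) \<and> (\<forall>F. ultrafilter F \<longrightarrow> (\<exists>!d. v d \<in> F))"
proof
  assume "finitely_central \<tau> boolean_semiring E v"
  then obtain I where v: "v \<in> carrier (boolean_vectors (carrier E))"
    and I: "finite I" "I \<noteq> {}" "I \<subseteq> carrier E" "central_wrt \<tau> boolean_semiring E I v"
    unfolding finitely_central_def carrier_vec_alg by blast
  show "v \<in> carrier (boolean_vectors (carrier E)) \<and> (\<forall>F. ultrafilter F \<longrightarrow> (\<exists>!d. v d \<in> F))"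
    using v central_wrt_imp_partition[OF E v I] by blast
next
  assume *: "v \<in> carrier (boolean_vectors (carrier E)) \<and> (\<forall>F. ultrafilter F \<longrightarrow> (\<exists>!d. v d \<in> F))"
  \<comment> \<open>The support alone may be empty: this happens when \<open>0 = 1\<close> in the Boolean algebra.\<close>
  obtain e0 where e0: "e0 \<in> carrier E" using E by (auto simp: is_algebra_def)
  let ?I = "insert e0 {d. v d \<noteq> bot}"
  have "finite ?I" "?I \<subseteq> carrier E" using * e0 by (auto simp: carrier_boolean_vectors)
  moreover from this have "central_wrt \<tau> boolean_semiring E ?I v"
    using * by (intro partition_imp_central_wrt E) auto
  ultimately show "finitely_central \<tau> boolean_semiring E v"
    using * unfolding finitely_central_def carrier_vec_alg by blast
qed


section \<open>The isomorphism with the Boolean power\<close>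

text \<open>Each fibre of \<open>f\<close> is open, so every ultrafilter contains an element
  \<open>a\<close> on whose basic set \<open>f\<close> is constant. Compactness leaves finitely many
  such elements, and \<open>v d\<close> is the join of those with value \<open>d\<close>; finiteness
  of \<open>B\<close> also yields finite support.\<close>

lemma continuous_map_imp_partition:
  fixes f :: "'r::boolean_algebra set \<Rightarrow> 'e"
  assumes f: "continuous_map stone_space (discrete_topology E) f"
  shows "\<exists>v\<in>carrier (boolean_vectors E). \<forall>F d. ultrafilter F \<longrightarrow> (v d \<in> F \<longleftrightarrow> f F = d)"
proof -
  have fE: "f F \<in> E" if "ultrafilter F" for F
    using f that by (auto simp: continuous_map_def topspace_stone_space)
  define P where "P a d \<longleftrightarrow> (\<forall>G. ultrafilter G \<and> a \<in> G \<longrightarrow> f G = d)" for a d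
  have "\<exists>a\<in>{a. \<exists>d. P a d}. a \<in> F" if F: "ultrafilter F" for F
  proof -
    have "openin stone_space {G \<in> topspace stone_space. f G \<in> {f F}}"
      using fE[OF F] by (intro openin_continuous_map_preimage[OF f]) simp
    moreover have "F \<in> {G \<in> topspace stone_space. f G \<in> {f F}}"
      using F by (simp add: topspace_stone_space)
    ultimately have "\<exists>a\<in>F. \<forall>G. ultrafilter G \<and> a \<in> G \<longrightarrow>
        G \<in> {G \<in> topspace stone_space. f G \<in> {f F}}"
      by (rule stone_space_basis)
    then obtain a where "a \<in> F" "P a (f F)" by (auto simp: P_def)
    then show ?thesis by blast
  qed
  then obtain B where B: "finite B" "B \<subseteq> {a. \<exists>d. P a d}" "\<And>F. ultrafilter F \<Longrightarrow> \<exists>a\<in>B. a \<in> F"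
    using ultrafilter_finite_subcover[of "{a. \<exists>d. P a d}"] by blast
  have "\<exists>c. \<forall>F. ultrafilter F \<longrightarrow> (c \<in> F \<longleftrightarrow> (\<exists>a\<in>{a \<in> B. P a d}. a \<in> F))" for d
    using B(1) by (intro finite_join_exists) simp
  then have "\<exists>v. \<forall>d F. ultrafilter F \<longrightarrow> (v d \<in> F \<longleftrightarrow> (\<exists>a\<in>{a \<in> B. P a d}. a \<in> F))"
    by (intro choice allI)
  then obtain v where "\<forall>d F. ultrafilter F \<longrightarrow> (v d \<in> F \<longleftrightarrow> (\<exists>a\<in>{a \<in> B. P a d}. a \<in> F))" ..
  then have v: "v d \<in> F \<longleftrightarrow> (\<exists>a\<in>B. P a d \<and> a \<in> F)" if "ultrafilter F" for d F
    using that by auto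
  have v_iff: "v d \<in> F \<longleftrightarrow> f F = d" if F: "ultrafilter F" for F d
  proof
    show "f F = d" if "v d \<in> F" using that v[OF F] F by (auto simp: P_def)
    show "v d \<in> F" if d: "f F = d"
    proof -
      obtain a d' where a: "a \<in> B" "a \<in> F" "P a d'" using B(2,3) F by blast
      then have "d' = d" using F d by (auto simp: P_def)
      then show ?thesis using a v[OF F] by blast
    qed
  qed
  have "v d = bot" if "d \<notin> E" for d
    using that fE v_iff by (intro eq_bot_if_no_ultrafilter) auto
  \<comment> \<open>\<open>P bot d\<close> holds vacuously for every \<open>d\<close>, so the value
    of \<open>THE\<close> is meaningful only for nonzero \<open>a\<close>. A nonzero
    \<open>v d\<close> supplies an ultrafilter containing some \<open>a \<in> B\<close> with
    \<open>P a d\<close>, which makes \<open>d\<close> unique.\<close>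
  moreover have "{d. v d \<noteq> bot} \<subseteq> (\<lambda>a. THE d. P a d) ` B"
  proof
    fix d assume "d \<in> {d. v d \<noteq> bot}"
    then obtain F where F: "ultrafilter F" "v d \<in> F" by (auto elim: ultrafilter_containing)
    then obtain a where a: "a \<in> B" "P a d" "a \<in> F" using v by blast
    then have "(THE d. P a d) = d" using F(1) by (intro the_equality) (auto simp: P_def)
    then show "d \<in> (\<lambda>a. THE d. P a d) ` B" using a by force
  qed
  then have "finite {d. v d \<noteq> bot}" using B(1) by (meson finite_imageI finite_subset)
  ultimately have "v \<in> carrier (boolean_vectors E)" by (simp add: carrier_boolean_vectors)
  then show ?thesis using v_iff by (intro bexI[of _ v]) auto
qed

text \<open>The preimage of a set \<open>U\<close> is the union of the basic open sets given by
  \<open>v d\<close> for \<open>d \<in> U\<close>.\<close>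

lemma partition_imp_continuous_map:
  fixes v :: "'e \<Rightarrow> 'r::boolean_algebra"
  assumes v: "v \<in> carrier (boolean_vectors E)"
    and f: "\<And>F d. ultrafilter F \<Longrightarrow> v d \<in> F \<longleftrightarrow> f F = d"
  shows "continuous_map stone_space (discrete_topology E) f"
proof -
  have "openin stone_space {F \<in> topspace stone_space. f F \<in> U}" for U
  proof -
    have "{F \<in> topspace stone_space. f F \<in> U} = (\<Union>d\<in>U. {F. ultrafilter F \<and> v d \<in> F})"
      using f by (auto simp: topspace_stone_space)
    moreover have "openin stone_space {F. ultrafilter F \<and> a \<in> F}" for a :: 'r
      unfolding stone_space_def by (rule topology_generated_by_Basis) blast
    ultimately show ?thesis by auto
  qed
  moreover have "f F \<in> E" if "ultrafilter F" for F
    using boolean_vector_mem[OF v that] f[OF that] by blast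
  ultimately show ?thesis by (auto simp: continuous_map_def topspace_stone_space)
qed

theorem theorem5p5:
  fixes \<tau> :: "'g signature" and E :: "('g, 'e) ualgebra"
  assumes "is_algebra \<tau> E"
  shows "isomorphic_algebras \<tau>
           (semiring_power \<tau> E (boolean_semiring :: 'r::boolean_algebra ring))
           (continuous_alg (stone_space :: 'r set topology) E)"
proof -
  let ?V = "carrier (boolean_vectors (carrier E)) :: ('e \<Rightarrow> 'r) set"
  let ?A = "semiring_power \<tau> E (boolean_semiring :: 'r ring)"
  let ?C = "continuous_alg (stone_space :: 'r set topology) E"
  define h :: "('e \<Rightarrow> 'r) \<Rightarrow> 'r set \<Rightarrow> 'e"
    where "h v = (\<lambda>F\<in>topspace stone_space. THE d. v d \<in> F)" for v
  have carA: "carrier ?A = {v \<in> ?V. \<forall>F. ultrafilter F \<longrightarrow> (\<exists>!d. v d \<in> F)}"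
    by (auto simp: semiring_power_def finitely_central_iff_partition[OF assms])
  \<comment> \<open>This equivalence determines \<open>v\<close> from \<open>h v\<close> and
    conversely, and replaces the definite description from here on.\<close>
  have h_iff: "v d \<in> F \<longleftrightarrow> h v F = d" if "v \<in> carrier ?A" "ultrafilter F" for v d F
  proof -
    have "\<exists>!d. v d \<in> F" using that carA by blast
    then have "v d \<in> F \<longleftrightarrow> d = (THE d. v d \<in> F)" by (rule theI_unique)
    then show ?thesis using that(2) by (simp add: h_def topspace_stone_space eq_commute[of d])
  qed
  have bij: "bij_betw h (carrier ?A) (carrier ?C)"
    unfolding bij_betw_def
  proof (intro conjI inj_onI equalityI subsetI)
    fix u w assume "u \<in> carrier ?A" "w \<in> carrier ?A" "h u = h w"
    then show "u = w" using h_iff by (intro boolean_vector_eqI) metis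
  next
    fix f assume "f \<in> h ` carrier ?A"
    then obtain v where v: "v \<in> carrier ?A" "f = h v" by blast
    have "v \<in> ?V" using v(1) carA by simp
    then have "continuous_map stone_space (discrete_topology (carrier E)) (h v)"
      using h_iff[OF v(1)] by (rule partition_imp_continuous_map)
    then show "f \<in> carrier ?C" using v by (simp add: continuous_alg_def h_def)
  next
    fix f assume "f \<in> carrier ?C"
    then have ext: "f \<in> extensional (topspace stone_space)"
      and cont: "continuous_map stone_space (discrete_topology (carrier E)) f"
      by (auto simp: continuous_alg_def)
    from continuous_map_imp_partition[OF cont] obtain v
      where v: "v \<in> ?V" "\<forall>F d. ultrafilter F \<longrightarrow> (v d \<in> F \<longleftrightarrow> f F = d)" ..
    then have vA: "v \<in> carrier ?A" unfolding carA by auto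
    moreover have "f = h v"
    proof (rule extensionalityI[OF ext])
      show "h v \<in> extensional (topspace stone_space)" by (simp add: h_def)
      show "f F = h v F" if "F \<in> topspace stone_space" for F
      proof -
        have F: "ultrafilter F" using that by (simp add: topspace_stone_space)
        then have "v (f F) \<in> F" using v(2) by simp
        then show ?thesis using h_iff[OF vA F] by simp
      qed
    qed
    ultimately show "f \<in> h ` carrier ?A" by blast
  qed
  have lift: "lifted_op boolean_semiring E g vs \<in> carrier ?A"
      "h (lifted_op boolean_semiring E g vs) = oper ?C g (map h vs)"
    if g: "g \<in> symbols \<tau>" and vs: "vs \<in> tuples (carrier ?A) (arity \<tau> g)" for g vs
  proof -
    let ?l = "lifted_op boolean_semiring E g vs"
    have vsV: "vs \<in> tuples ?V (arity \<tau> g)" using vs carA by (auto simp: tuples_def)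
    \<comment> \<open>Each argument has exactly one coordinate in \<open>F\<close>, so the
      elementwise operation on sets collapses to a single value of \<open>g\<close>. This gives both
      closure of the power under \<open>g\<close> and the homomorphism property.\<close>
    have l_iff: "?l d \<in> F \<longleftrightarrow> d = oper E g (map (\<lambda>v. h v F) vs)" if F: "ultrafilter F" for d F
    proof -
      have "list_all2 (\<lambda>v d. v d \<in> F) vs ds \<longleftrightarrow> ds = map (\<lambda>v. h v F) vs" for ds
      proof -
        have "(vs ! i) d \<in> F \<longleftrightarrow> h (vs ! i) F = d" if "i < length vs" for i d
          by (rule h_iff[OF _ F]) (use vs that in \<open>auto simp: tuples_def\<close>)
        then show ?thesis by (auto simp: list_all2_conv_all_nth list_eq_iff_nth_eq)
      qed
      then show ?thesis unfolding lifted_op_boolean(2)[OF assms g vsV F] by simp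
    qed
    show lA: "?l \<in> carrier ?A"
      unfolding carA using lifted_op_boolean(1)[OF assms g vsV] by (simp add: l_iff)
    show "h ?l = oper ?C g (map h vs)"
    proof (rule extensionalityI[of _ "topspace stone_space"])
      show "h ?l F = oper ?C g (map h vs) F" if "F \<in> topspace stone_space" for F
      proof -
        have F: "ultrafilter F" using that by (simp add: topspace_stone_space)
        then have "h ?l F = oper E g (map (\<lambda>v. h v F) vs)"
          using l_iff by (simp flip: h_iff[OF lA F])
        then show ?thesis using that by (simp add: continuous_alg_def comp_def)
      qed
    qed (simp_all add: h_def continuous_alg_def)
  qed
  have "carrier ?A \<noteq> {}"
  proof -
    obtain e where "e \<in> carrier E" using assms by (auto simp: is_algebra_def)
    then have "unit_vec boolean_semiring e \<in> carrier ?A"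
      unfolding carA by (auto simp: unit_vec_closed unit_vec_in_ultrafilter)
    then show ?thesis by blast
  qed
  then have algA: "is_algebra \<tau> ?A"
    using lift(1) by (auto simp: is_algebra_def semiring_power_def)
  \<comment> \<open>Closure of the Boolean power is transported along \<open>h\<close>: continuous
    functions are images of vectors, and \<open>h\<close> maps the result of the lifted operation to
    the pointwise one.\<close>
  have "oper ?C g fs \<in> carrier ?C"
    if g: "g \<in> symbols \<tau>" and fs: "fs \<in> tuples (carrier ?C) (arity \<tau> g)" for g fs
  proof -
    let ?vs = "map (inv_into (carrier ?A) h) fs"
    have "map h ?vs = fs"
      using fs bij by (auto simp: tuples_def bij_betw_def f_inv_into_f intro!: map_idI)
    moreover have "?vs \<in> tuples (carrier ?A) (arity \<tau> g)"
      using fs bij by (auto simp: tuples_def bij_betw_def intro!: inv_into_into)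
    ultimately show ?thesis using lift[OF g, of ?vs] bij by (metis bij_betwE)
  qed
  moreover have "carrier ?C \<noteq> {}" using bij \<open>carrier ?A \<noteq> {}\<close> by (auto simp: bij_betw_def)
  ultimately have "is_algebra \<tau> ?C" by (simp add: is_algebra_def)
  with algA bij lift(2) have "alg_iso \<tau> ?A ?C h"
    by (simp add: alg_iso_def semiring_power_def)
  then show ?thesis unfolding isomorphic_algebras_def by blast
qed

end
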